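(* Assume (a standing conjectural assumption) that there exists a constant $N$ such that, for every souped-up Lie algebra $\mathfrak{s}$, one has $I(\mathfrak{s})\cap\mathfrak{s}=\{0\}$ when the souped-up vertex algebra ideal $I(\mathfrak{s})$ is formed with $N(s,t)\equiv N$. In general, even if a souped-up Lie algebra $\mathfrak{s}=\mathfrak{s}(\mathfrak{g},\mathfrak{a})$ is regarded as a two-sided module for $\mathfrak{a}$ with the relation $as=sa$, the set of generators $a_{-1}s-as$ of $I(\mathfrak{s})$ ($a\in\mathfrak{a}$, $s\in\mathfrak{s}$) may not be enlarged to include the elements $s_{-1}a-as$.
   Context: Conventions. Vector spaces are $\mathbf{Z}/2$-graded, with parity $p$; "commutative", "Lie algebra", etc. are meant in the super sense. A unital vector space is a vector space with a distinguished vector $\mathbf{1}$. For a unital vector space $\mathfrak{v}$, $F(\mathfrak{v})$ is the infinite free algebra generated by $\mathfrak{v}$: the closure of $\mathfrak{v}$ under addition and under totally nonassociative, noncommutative bilinear products $x\circ_n y=x_ny$, $n\in\mathbf{Z}$ (no relations other than bilinearity). A monomial is an iterated product of elements of $\mathfrak{v}$. Ideals are closed with respect to all products $\circ_n$. Put $Dx=x_{-2}\mathbf{1}$. Vertex algebra generators. Given a function $N(u,v)\ge 0$ on $\mathfrak{v}\times\mathfrak{v}$, these are, for $u,v\in\mathfrak{v}$ and $x,y,z\in F(\mathfrak{v})$ (which by linearity may be taken to be monomials): - $\mathbf{1}_nx-\delta_{n,-1}x$; - $u_nv$ for all $n\ge N(u,v)$; - $D(x_ny)-(Dx)_ny-x_n(Dy)$;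 - $(Dx)_ny+n\,x_{n-1}y$ for all $n\in\mathbf{Z}$; - $x_ny+(-1)^{p(x)p(y)}\sum_{k\ge0}\frac{(-1)^{n+k}}{k!}D^k(y_{n+k}x)$; - $(x_my)_nz-\sum_{k\ge0}\binom{m}{k}(-1)^k\big(x_{m-k}(y_{n+k}z)-(-1)^{m+p(x)p(y)}y_{m+n-k}(x_kz)\big)$; where, unless indicated otherwise, $m,n$ take the value $-1$ and all values $\gg0$. The tails of the infinite sums vanish modulo the ideal, because products $x_ny$ with $n$ sufficiently large (depending on $x,y$) lie in the ideal. Souped-up Lie algebra $\mathfrak{s}=\mathfrak{s}(\mathfrak{g},\mathfrak{a})$: $\mathfrak{a}$ is an associative commutative unital algebra with unit $\mathbf{1}\neq0$; $\mathfrak{g}$ is a Lie algebra that is a left $\mathfrak{a}$-module (product written by juxtaposition); $\mathfrak{a}$ is a two-sided $\mathfrak{g}$-module on which $\mathfrak{g}$ acts by derivations, the action being written as a bracket $[\cdot,\cdot]$; and $[g,ah]=[g,a]h+a[g,h]$ for $a\in\mathfrak{a}$, $g,h\in\mathfrak{g}$. Then $\mathfrak{s}$ is the semidirect sum Lie algebra $\mathfrak{g}\oplus\mathfrak{a}$ ($\mathfrak{a}$ regarded as an abelian Lie algebra) together with left multiplication by $\mathfrak{a}$; its distinguished vector is $\mathbf{1}\in\mathfrak{a}$. Souped-up vertex algebra ideal. $I(\mathfrak{s})\subset F(\mathfrak{s})$ is the ideal generated by the vertex algebra generators above (for the unital vector space underlying $\mathfrak{s}$, with a chosen function $N(s,t)\ge0$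 on $\mathfrak{s}\times\mathfrak{s}$) and by the elements $s_0t-[s,t]$, $a_{-1}s-as$, and $(ab)_{-1}x-a_{-1}(b_{-1}x)$, for $a,b\in\mathfrak{a}$, $s,t\in\mathfrak{s}$ and monomials $x\in F(\mathfrak{s})$. Vertex algebra generated by $\mathfrak{s}$. Give $F(\mathfrak{s})$ the grading determined by $|\mathfrak{g}|=1$, $|\mathfrak{a}|=0$, $|x_ny|=|x|+|y|-n-1$. A vertex algebra $V(\mathfrak{s})$ is a quotient $F(\mathfrak{s})/J$ where $J$ is a proper ideal containing $I(\mathfrak{s})$ and decomposing into homogeneous subspaces for this grading; a zero quotient is not regarded as a vertex algebra. *)

theory Defs
  imports Complex_Main "HOL-Library.Poly_Mapping"
begin

section \<open>The infinite free algebra\<close>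

text \<open>
  All vector spaces are over a field \<open>'k\<close> of characteristic 0.
  The type \<open>('i, 'k) vec\<close> is the vector space with basis \<open>'i\<close>.  Up to isomorphism its subspaces are
  exactly the vector spaces of dimension at most the cardinality of \<open>'i\<close>, and a ``vector space''
  is represented below by such a subspace (no basis of the subspace is singled out).
\<close>

type_synonym ('i, 'k) vec = "'i \<Rightarrow>\<^sub>0 'k"

datatype 'i tree = Leaf 'i | Node int "'i tree" "'i tree"

text \<open>
  The free algebra on the whole ambient space: its basis consists of all iterated products of basis
  vectors, \<open>Node n a b\<close> being the \<open>n\<close>-th product of \<open>a\<close> and \<open>b\<close>.
\<close>

type_synonym ('i, 'k) alg = "'i tree \<Rightarrow>\<^sub>0 'k"

abbreviation lookup :: "('x \<Rightarrow>\<^sub>0 'k::zero) \<Rightarrow> 'x \<Rightarrow> 'k" where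
  "lookup \<equiv> Poly_Mapping.lookup"

abbreviation keys :: "('x \<Rightarrow>\<^sub>0 'k::zero) \<Rightarrow> 'x set" where
  "keys \<equiv> Poly_Mapping.keys"

definition pscale :: "'k::field \<Rightarrow> ('x \<Rightarrow>\<^sub>0 'k) \<Rightarrow> ('x \<Rightarrow>\<^sub>0 'k)" where
  "pscale c f = Poly_Mapping.map ((*) c) f"

lemma lookup_pscale: "lookup (pscale c f) x = c * lookup f x"
  by (simp add: pscale_def map.rep_eq when_def)

interpretation pmod: vector_space "pscale :: 'k::field \<Rightarrow> ('x \<Rightarrow>\<^sub>0 'k) \<Rightarrow> ('x \<Rightarrow>\<^sub>0 'k)"
  by standard (auto intro!: poly_mapping_eqI simp: lookup_pscale lookup_add algebra_simps)

definition emb :: "('i, 'k::field) vec \<Rightarrow> ('i, 'k) alg" where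
  "emb u = (\<Sum>i\<in>keys u. Poly_Mapping.single (Leaf i) (lookup u i))"

definition nprod :: "int \<Rightarrow> ('i, 'k::field) alg \<Rightarrow> ('i, 'k) alg \<Rightarrow> ('i, 'k) alg" where
  "nprod n x y =
     (\<Sum>a\<in>keys x. \<Sum>b\<in>keys y. Poly_Mapping.single (Node n a b) (lookup x a * lookup y b))"

lemma emb_superset:
  assumes "finite A" "keys u \<subseteq> A"
  shows "emb u = (\<Sum>i\<in>A. Poly_Mapping.single (Leaf i) (lookup u i))"
  unfolding emb_def using assms by (intro sum.mono_neutral_left) (auto simp: in_keys_iff)

lemma emb_add: "emb (u + v) = emb u + emb v"
proof -
  have "keys (u + v) \<subseteq> keys u \<union> keys v" by (rule Poly_Mapping.keys_add)
  then show ?thesis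
    by (simp add: emb_superset[of "keys u \<union> keys v"] lookup_add single_add sum.distrib)
qed

lemma nprod_superset:
  assumes "finite A" "keys x \<subseteq> A" "finite B" "keys y \<subseteq> B"
  shows "nprod n x y =
    (\<Sum>a\<in>A. \<Sum>b\<in>B. Poly_Mapping.single (Node n a b) (lookup x a * lookup y b))"
proof -
  have "nprod n x y =
      (\<Sum>a\<in>keys x. \<Sum>b\<in>B. Poly_Mapping.single (Node n a b) (lookup x a * lookup y b))"
    unfolding nprod_def using assms
    by (intro sum.cong refl sum.mono_neutral_left) (auto simp: in_keys_iff)
  also have "\<dots> = (\<Sum>a\<in>A. \<Sum>b\<in>B. Poly_Mapping.single (Node n a b) (lookup x a * lookup y b))"
    using assms by (intro sum.mono_neutral_left) (auto simp: in_keys_iff)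
  finally show ?thesis .
qed

lemma nprod_add_left: "nprod n (x + x') y = nprod n x y + nprod n x' y"
proof -
  have "keys (x + x') \<subseteq> keys x \<union> keys x'" by (rule Poly_Mapping.keys_add)
  then show ?thesis
    by (simp add: nprod_superset[of "keys x \<union> keys x'" _ "keys y"] lookup_add single_add
        sum.distrib algebra_simps)
qed

lemma nprod_add_right: "nprod n x (y + y') = nprod n x y + nprod n x y'"
proof -
  have "keys (y + y') \<subseteq> keys y \<union> keys y'" by (rule Poly_Mapping.keys_add)
  then show ?thesis
    by (simp add: nprod_superset[of "keys x" _ "keys y \<union> keys y'"] lookup_add single_add
        sum.distrib algebra_simps)
qed


section \<open>Unital vector spaces and their free algebras\<close>

text \<open>Parity is a Boolean, \<open>True\<close> meaning odd; \<open>part v p\<close> is the subspace of vectors of parity \<open>p\<close>.\<close>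

record (overloaded) ('i, 'k) uvs =
  part :: "bool \<Rightarrow> ('i \<Rightarrow>\<^sub>0 'k) set"
  unt :: "'i \<Rightarrow>\<^sub>0 'k"

text \<open>The sign \<open>(-1)\<close> to the power \<open>p q\<close>.\<close>

definition sgn2 :: "bool \<Rightarrow> bool \<Rightarrow> 'k::field" where
  "sgn2 p q = (if p \<and> q then - 1 else 1)"

definition carr :: "('i, 'k::field, 'z) uvs_scheme \<Rightarrow> ('i, 'k) vec set" where
  "carr v = {x + y | x y. x \<in> part v False \<and> y \<in> part v True}"

definition unital_space :: "('i, 'k::field, 'z) uvs_scheme \<Rightarrow> bool" where
  "unital_space v \<longleftrightarrow>
     (\<forall>p. pmod.subspace (part v p)) \<and> part v False \<inter> part v True = {0} \<and> unt v \<in> part v False"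

text \<open>
  \<open>F(v)\<close>, the closure of \<open>v\<close> under addition and all products.  Since \<open>v\<close> is a subspace of the
  ambient space, the subalgebra it generates in the free algebra of the ambient space is free on
  \<open>v\<close>: only bilinear relations hold.
\<close>

inductive_set free_alg :: "('i, 'k::field, 'z) uvs_scheme \<Rightarrow> ('i, 'k) alg set"
  for v where
  gen: "u \<in> carr v \<Longrightarrow> emb u \<in> free_alg v"
| add: "x \<in> free_alg v \<Longrightarrow> y \<in> free_alg v \<Longrightarrow> x + y \<in> free_alg v"
| prod: "x \<in> free_alg v \<Longrightarrow> y \<in> free_alg v \<Longrightarrow> nprod n x y \<in> free_alg v"

inductive_set monomials :: "('i, 'k::field, 'z) uvs_scheme \<Rightarrow> ('i, 'k) alg set"
  for v where
  gen: "u \<in> carr v \<Longrightarrow> emb u \<in> monomials v"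
| prod: "x \<in> monomials v \<Longrightarrow> y \<in> monomials v \<Longrightarrow> nprod n x y \<in> monomials v"

text \<open>Monomials in parity-homogeneous elements of \<open>v\<close>, with their parity.\<close>

inductive par_mono :: "('i, 'k::field, 'z) uvs_scheme \<Rightarrow> bool \<Rightarrow> ('i, 'k) alg \<Rightarrow> bool"
  for v where
  gen: "u \<in> part v p \<Longrightarrow> par_mono v p (emb u)"
| prod: "par_mono v p x \<Longrightarrow> par_mono v q y \<Longrightarrow> par_mono v (p \<noteq> q) (nprod n x y)"

definition is_ideal :: "('i, 'k::field, 'z) uvs_scheme \<Rightarrow> ('i, 'k) alg set \<Rightarrow> bool" where
  "is_ideal v I \<longleftrightarrow> I \<subseteq> free_alg v \<and> pmod.subspace I \<and>
     (\<forall>x\<in>I. \<forall>y\<in>free_alg v. \<forall>n. nprod n x y \<in> I \<and> nprod n y x \<in> I)"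

definition deriv :: "('i, 'k::field, 'z) uvs_scheme \<Rightarrow> ('i, 'k) alg \<Rightarrow> ('i, 'k) alg" where
  "deriv v x = nprod (- 2) x (emb (unt v))"


section \<open>Vertex algebra generators\<close>

text \<open>
  ``\<open>n\<close> takes the value \<open>-1\<close> and all values \<open>\<gg> 0\<close>'': the bound \<open>T xs\<close> beyond which \<open>n\<close> is allowed may
  depend on the list \<open>xs\<close> of monomials occurring in the generator.
\<close>

definition idx :: "(('i, 'k::zero) alg list \<Rightarrow> nat) \<Rightarrow> ('i, 'k) alg list \<Rightarrow> int set" where
  "idx T xs = insert (- 1) {n. int (T xs) \<le> n}"

text \<open>
  \<open>x - \<Sum>\<^sub>k t k \<in> I\<close> for an infinite sum that makes sense modulo \<open>I\<close>: if the terms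
  \<open>t k\<close> lie in \<open>I\<close> from \<open>K\<close> on, the sum is truncated at \<open>K\<close> (for an ideal \<open>I\<close>, the choice of such
  a \<open>K\<close> is immaterial).
\<close>

definition contains_minus_sum ::
  "('i, 'k::field) alg set \<Rightarrow> ('i, 'k) alg \<Rightarrow> (nat \<Rightarrow> ('i, 'k) alg) \<Rightarrow> bool" where
  "contains_minus_sum I x t \<longleftrightarrow> (\<forall>K. (\<forall>k\<ge>K. t k \<in> I) \<longrightarrow> x - (\<Sum>k<K. t k) \<in> I)"

definition skew_term :: "('i, 'k::field_char_0, 'z) uvs_scheme \<Rightarrow> bool \<Rightarrow> bool \<Rightarrow> int \<Rightarrow>
    ('i, 'k) alg \<Rightarrow> ('i, 'k) alg \<Rightarrow> nat \<Rightarrow> ('i, 'k) alg" where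
  "skew_term v p q n x y k =
     pscale (sgn2 p q * ((- 1) powi (n + int k) / fact k))
       ((deriv v ^^ k) (nprod (n + int k) y x))"

definition assoc_term :: "bool \<Rightarrow> bool \<Rightarrow> int \<Rightarrow> int \<Rightarrow>
    ('i, 'k::field_char_0) alg \<Rightarrow> ('i, 'k) alg \<Rightarrow> ('i, 'k) alg \<Rightarrow> nat \<Rightarrow> ('i, 'k) alg" where
  "assoc_term p q m n x y z k =
     pscale ((of_int m gchoose k) * (- 1) ^ k)
       (nprod (m - int k) x (nprod (n + int k) y z)
        - pscale ((- 1) powi m * sgn2 p q) (nprod (m + n - int k) y (nprod (int k) x z)))"

text \<open>The ideal \<open>I\<close> contains the vertex algebra generators.\<close>

definition contains_vertex_gens :: "('i, 'k::field_char_0, 'z) uvs_scheme \<Rightarrow>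
    (('i, 'k) vec \<Rightarrow> ('i, 'k) vec \<Rightarrow> nat) \<Rightarrow> (('i, 'k) alg list \<Rightarrow> nat) \<Rightarrow>
    ('i, 'k) alg set \<Rightarrow> bool" where
  "contains_vertex_gens v N T I \<longleftrightarrow>
     (\<forall>x\<in>monomials v. \<forall>n\<in>idx T [x].
        nprod n (emb (unt v)) x - (if n = - 1 then x else 0) \<in> I) \<and>
     (\<forall>u\<in>carr v. \<forall>w\<in>carr v. \<forall>n\<ge>int (N u w). nprod n (emb u) (emb w) \<in> I) \<and>
     (\<forall>x\<in>monomials v. \<forall>y\<in>monomials v. \<forall>n\<in>idx T [x, y].
        deriv v (nprod n x y) - nprod n (deriv v x) y - nprod n x (deriv v y) \<in> I) \<and>
     (\<forall>x\<in>monomials v. \<forall>y\<in>monomials v. \<forall>n.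
        nprod n (deriv v x) y + pscale (of_int n) (nprod (n - 1) x y) \<in> I) \<and>
     (\<forall>p q x y. par_mono v p x \<longrightarrow> par_mono v q y \<longrightarrow> (\<forall>n\<in>idx T [x, y].
        contains_minus_sum I (nprod n x y) (\<lambda>k. - skew_term v p q n x y k))) \<and>
     (\<forall>p q r x y z. par_mono v p x \<longrightarrow> par_mono v q y \<longrightarrow> par_mono v r z \<longrightarrow>
        (\<forall>m\<in>idx T [x, y, z]. \<forall>n\<in>idx T [x, y, z].
        contains_minus_sum I (nprod n (nprod m x y) z) (assoc_term p q m n x y z)))"

text \<open>
  The ideal generated by the vertex algebra generators and the set \<open>G\<close>.  The conditions on \<open>I\<close>
  are stable under intersection, so this is the least ideal satisfying them.
\<close>

definition vertex_ideal :: "('i, 'k::field_char_0, 'z) uvs_scheme \<Rightarrow>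
    (('i, 'k) vec \<Rightarrow> ('i, 'k) vec \<Rightarrow> nat) \<Rightarrow> (('i, 'k) alg list \<Rightarrow> nat) \<Rightarrow>
    ('i, 'k) alg set \<Rightarrow> ('i, 'k) alg set" where
  "vertex_ideal v N T G = \<Inter> {I. is_ideal v I \<and> contains_vertex_gens v N T I \<and> G \<subseteq> I}"


section \<open>Souped-up Lie algebras\<close>

text \<open>
  \<open>lie\<close> and \<open>fn\<close> are the subspaces g and a of s = g + a.  The bracket on s comprises the bracket of
  g, the two-sided action of g on a, and the zero bracket on a; \<open>act a x\<close> is the product \<open>a x\<close>
  for \<open>a\<close> in a and \<open>x\<close> in s.  Outside the given subspaces the two operations are irrelevant.
\<close>

record (overloaded) ('i, 'k) soup = "('i, 'k) uvs" +
  lie :: "('i \<Rightarrow>\<^sub>0 'k) set"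
  fn :: "('i \<Rightarrow>\<^sub>0 'k) set"
  brk :: "('i \<Rightarrow>\<^sub>0 'k) \<Rightarrow> ('i \<Rightarrow>\<^sub>0 'k) \<Rightarrow> ('i \<Rightarrow>\<^sub>0 'k)"
  act :: "('i \<Rightarrow>\<^sub>0 'k) \<Rightarrow> ('i \<Rightarrow>\<^sub>0 'k) \<Rightarrow> ('i \<Rightarrow>\<^sub>0 'k)"

definition graded_subspace ::
  "('i, 'k::field, 'z) uvs_scheme \<Rightarrow> ('i, 'k) vec set \<Rightarrow> bool" where
  "graded_subspace v W \<longleftrightarrow> pmod.subspace W \<and>
     W = {x + y | x y. x \<in> W \<inter> part v False \<and> y \<in> W \<inter> part v True}"

text \<open>A bilinear even operation on \<open>A \<times> B\<close> with values in \<open>v\<close>.\<close>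

definition even_bilinear :: "('i, 'k::field, 'z) uvs_scheme \<Rightarrow>
    ('i, 'k) vec set \<Rightarrow> ('i, 'k) vec set \<Rightarrow>
    (('i, 'k) vec \<Rightarrow> ('i, 'k) vec \<Rightarrow> ('i, 'k) vec) \<Rightarrow> bool" where
  "even_bilinear v A B f \<longleftrightarrow>
     (\<forall>x\<in>A. \<forall>x'\<in>A. \<forall>y\<in>B. f (x + x') y = f x y + f x' y) \<and>
     (\<forall>x\<in>A. \<forall>y\<in>B. \<forall>y'\<in>B. f x (y + y') = f x y + f x y') \<and>
     (\<forall>c. \<forall>x\<in>A. \<forall>y\<in>B. f (pscale c x) y = pscale c (f x y) \<and> f x (pscale c y) = pscale c (f x y)) \<and>
     (\<forall>p q. \<forall>x\<in>A \<inter> part v p. \<forall>y\<in>B \<inter> part v q. f x y \<in> part v (p \<noteq> q))"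

definition souped_up :: "('i, 'k::field) soup \<Rightarrow> bool" where
  "souped_up s \<longleftrightarrow>
     unital_space s \<and> graded_subspace s (lie s) \<and> graded_subspace s (fn s) \<and>
     lie s \<inter> fn s = {0} \<and> carr s = {g + a | g a. g \<in> lie s \<and> a \<in> fn s} \<and>
     unt s \<in> fn s \<and> unt s \<noteq> 0 \<and>
     \<comment> \<open>the Lie algebra s, a semidirect sum of g and the abelian ideal a\<close>
     even_bilinear s (carr s) (carr s) (brk s) \<and>
     (\<forall>p q. \<forall>x\<in>part s p. \<forall>y\<in>part s q. brk s x y = - pscale (sgn2 p q) (brk s y x)) \<and>
     (\<forall>p q r. \<forall>x\<in>part s p. \<forall>y\<in>part s q. \<forall>z\<in>part s r.
        brk s x (brk s y z) = brk s (brk s x y) z + pscale (sgn2 p q) (brk s y (brk s x z))) \<and>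
     (\<forall>g\<in>lie s. \<forall>h\<in>lie s. brk s g h \<in> lie s) \<and>
     (\<forall>g\<in>lie s. \<forall>a\<in>fn s. brk s g a \<in> fn s) \<and>
     (\<forall>a\<in>fn s. \<forall>b\<in>fn s. brk s a b = 0) \<and>
     \<comment> \<open>the associative commutative algebra a and its module g\<close>
     even_bilinear s (fn s) (carr s) (act s) \<and>
     (\<forall>a\<in>fn s. \<forall>b\<in>fn s. act s a b \<in> fn s) \<and>
     (\<forall>a\<in>fn s. \<forall>g\<in>lie s. act s a g \<in> lie s) \<and>
     (\<forall>p q. \<forall>a\<in>fn s \<inter> part s p. \<forall>b\<in>fn s \<inter> part s q. act s a b = pscale (sgn2 p q) (act s b a)) \<and>
     (\<forall>a\<in>fn s. \<forall>b\<in>fn s. \<forall>x\<in>carr s. act s (act s a b) x = act s a (act s b x)) \<and>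
     (\<forall>x\<in>carr s. act s (unt s) x = x) \<and>
     \<comment> \<open>g acts on a by derivations, and the Leibniz rule for g acting on a g\<close>
     (\<forall>p q. \<forall>g\<in>lie s \<inter> part s p. \<forall>a\<in>fn s \<inter> part s q. \<forall>b\<in>fn s.
        brk s g (act s a b) = act s (brk s g a) b + pscale (sgn2 p q) (act s a (brk s g b))) \<and>
     (\<forall>p q. \<forall>g\<in>lie s \<inter> part s p. \<forall>a\<in>fn s \<inter> part s q. \<forall>h\<in>lie s.
        brk s g (act s a h) = act s (brk s g a) h + pscale (sgn2 p q) (act s a (brk s g h)))"

definition soup_gens :: "('i, 'k::field) soup \<Rightarrow> ('i, 'k) alg set" where
  "soup_gens s =
     {nprod 0 (emb x) (emb y) - emb (brk s x y) | x y. x \<in> carr s \<and> y \<in> carr s} \<union>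
     {nprod (- 1) (emb a) (emb x) - emb (act s a x) | a x. a \<in> fn s \<and> x \<in> carr s} \<union>
     {nprod (- 1) (emb (act s a b)) x - nprod (- 1) (emb a) (nprod (- 1) (emb b) x) | a b x.
        a \<in> fn s \<and> b \<in> fn s \<and> x \<in> monomials s}"

text \<open>
  The elements \<open>x\<^sub>-\<^sub>1 a - a x\<close>.  In the super sense the relation \<open>a x = x a\<close> carries a sign
  for odd \<open>a\<close> and \<open>x\<close>; by linearity it suffices to take homogeneous elements.
\<close>

definition right_gens :: "('i, 'k::field) soup \<Rightarrow> ('i, 'k) alg set" where
  "right_gens s =
     {nprod (- 1) (emb x) (emb a) - pscale (sgn2 p q) (emb (act s a x)) | p q a x.
        a \<in> fn s \<inter> part s p \<and> x \<in> part s q}"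

text \<open>\<open>I(s)\<close>, and the ideal obtained from the enlarged set of generators.\<close>

definition soup_ideal :: "(('i, 'k::field_char_0) vec \<Rightarrow> ('i, 'k) vec \<Rightarrow> nat) \<Rightarrow>
    (('i, 'k) alg list \<Rightarrow> nat) \<Rightarrow> ('i, 'k) soup \<Rightarrow> ('i, 'k) alg set" where
  "soup_ideal N T s = vertex_ideal s N T (soup_gens s)"

definition enlarged_soup_ideal :: "(('i, 'k::field_char_0) vec \<Rightarrow> ('i, 'k) vec \<Rightarrow> nat) \<Rightarrow>
    (('i, 'k) alg list \<Rightarrow> nat) \<Rightarrow> ('i, 'k) soup \<Rightarrow> ('i, 'k) alg set" where
  "enlarged_soup_ideal N T s = vertex_ideal s N T (soup_gens s \<union> right_gens s)"


section \<open>Vertex algebras generated by souped-up Lie algebras\<close>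

inductive deg_mono :: "('i, 'k::field) soup \<Rightarrow> int \<Rightarrow> ('i, 'k) alg \<Rightarrow> bool"
  for s where
  fn: "a \<in> fn s \<Longrightarrow> deg_mono s 0 (emb a)"
| lie: "g \<in> lie s \<Longrightarrow> deg_mono s 1 (emb g)"
| prod: "deg_mono s d x \<Longrightarrow> deg_mono s e y \<Longrightarrow> deg_mono s (d + e - n - 1) (nprod n x y)"

text \<open>
  \<open>F(s)/J\<close> is a vertex algebra \<open>V(s)\<close>: \<open>J\<close> is a proper ideal containing \<open>I(s)\<close> that
  decomposes into homogeneous subspaces, for the degree and (as any subspace in the super sense)
  for the parity.
\<close>

definition defines_vertex_algebra ::
  "(('i, 'k::field_char_0) vec \<Rightarrow> ('i, 'k) vec \<Rightarrow> nat) \<Rightarrow>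
   (('i, 'k) alg list \<Rightarrow> nat) \<Rightarrow> ('i, 'k) soup \<Rightarrow> ('i, 'k) alg set \<Rightarrow> bool" where
  "defines_vertex_algebra N T s J \<longleftrightarrow>
     is_ideal s J \<and> J \<noteq> free_alg s \<and> soup_ideal N T s \<subseteq> J \<and>
     J = pmod.span (\<Union>d. J \<inter> pmod.span {x. deg_mono s d x}) \<and>
     J = pmod.span (\<Union>p. J \<inter> pmod.span {x. par_mono s p x})"

end

theory Submission
  imports Defs "HOL-Computational_Algebra.Polynomial" "HOL-Library.Nat_Bijection"
begin

text \<open>
  The obstruction comes from skew symmetry.  Modulo \<open>I(s)\<close> it reads
  \<open>g\<^sub>-\<^sub>1 a = \<plusminus> (a\<^sub>-\<^sub>1 g - D (a\<^sub>0 g) + D\<^sup>2 (a\<^sub>1 g) / 2 - \<dots>)\<close>, so imposing \<open>g\<^sub>-\<^sub>1 a = \<plusminus> a g\<close> in addition to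
  \<open>a\<^sub>-\<^sub>1 g = a g\<close> forces \<open>w = D (a\<^sub>0 g) - D\<^sup>2 (a\<^sub>1 g) / 2 + \<dots>\<close> to vanish.  Little is
  known about the products \<open>a\<^sub>k g\<close> with \<open>k \<ge> 1\<close>, but they disappear from \<open>w\<^sub>1 z\<close>: since
  \<open>(D x)\<^sub>n z = - n x\<^sub>n\<^sub>-\<^sub>1 z\<close>, one has \<open>(D x)\<^sub>1 z = - x\<^sub>0 z\<close> and \<open>(D\<^sup>k x)\<^sub>1 z = 0\<close> for \<open>k \<ge> 2\<close>.  What
  remains is \<open>(a\<^sub>0 g)\<^sub>0 z = 0\<close>, hence \<open>[[a, g], h] = 0\<close> for all \<open>h\<close>
  (\<open>double_bracket_in_ideal\<close>).

  This identity fails badly for polynomial vector fields on the line: for the function \<open>X\<close> and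
  the vector fields \<open>X \<partial>\<close> and \<open>\<partial>\<close> the double bracket is the unit \<open>\<one>\<close>.  An
  ideal that contains \<open>\<one>\<close> and \<open>I(s)\<close> contains every \<open>x\<close>, because
  \<open>\<one>\<^sub>-\<^sub>1 x = x\<close> modulo \<open>I(s)\<close>; so the enlarged relations admit no nonzero quotient.  By the
  conjectural assumption this \<open>s\<close> does embed in \<open>F(s)/I(s)\<close>, so the enlargement alone is to blame.
\<close>

section \<open>Consequences of the enlarged relations\<close>

lemma lookup_emb_Leaf: "lookup (emb u) (Leaf i) = lookup u i"
  by (simp add: emb_def lookup_sum lookup_single when_def in_keys_iff)

lemma emb_eq_0_iff: "emb u = 0 \<longleftrightarrow> u = 0"
  by (metis emb_def lookup_emb_Leaf keys_zero poly_mapping_eqI lookup_zero sum.empty)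

lemma part_subset_carr: "unital_space v \<Longrightarrow> part v p \<subseteq> carr v"
proof
  fix u assume v: "unital_space v" and u: "u \<in> part v p"
  have z: "0 \<in> part v q" for q using v by (auto simp: unital_space_def pmod.subspace_0)
  have "\<exists>x y. u = x + y \<and> x \<in> part v False \<and> y \<in> part v True"
  proof (cases p)
    case True
    then show ?thesis using u z by (intro exI[of _ 0] exI[of _ u]) auto
  next
    case False
    then show ?thesis using u z by (intro exI[of _ u] exI[of _ 0]) auto
  qed
  then show "u \<in> carr v" unfolding carr_def by blast
qed

lemma monomial_in_free_alg: "x \<in> monomials v \<Longrightarrow> x \<in> free_alg v"
  by (induction rule: monomials.induct) (auto intro: free_alg.intros)

lemma ideal_diff: "is_ideal v J \<Longrightarrow> x \<in> J \<Longrightarrow> y \<in> J \<Longrightarrow> x - y \<in> J"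
  by (auto simp: is_ideal_def pmod.subspace_diff)

lemma nprod_diff_left: "nprod n (x - x') y = nprod n x y - nprod n x' y"
  by (metis nprod_add_left add_diff_cancel_right' diff_add_cancel)

lemma pscale_single: "pscale c (Poly_Mapping.single a b) = Poly_Mapping.single a (c * b)"
  by (rule poly_mapping_eqI) (simp add: lookup_pscale lookup_single when_def)

lemma nprod_scale_left: "nprod n (pscale c x) y = pscale c (nprod n x y)"
proof -
  have "keys (pscale c x) \<subseteq> keys x"
    by (auto simp: in_keys_iff lookup_pscale)
  then show ?thesis
    by (simp add: nprod_superset[of "keys x" _ "keys y"] lookup_pscale pmod.scale_sum_right
        pscale_single mult.assoc)
qed

lemma nprod_sum_left: "nprod n (sum f A) y = (\<Sum>a\<in>A. nprod n (f a) y)"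
proof -
  have "nprod n 0 y = 0" by (simp add: nprod_def)
  then show ?thesis
    by (induction A rule: infinite_finite_induct) (simp_all add: nprod_add_left)
qed

lemma derivs_in_monomials:
  "unital_space v \<Longrightarrow> x \<in> monomials v \<Longrightarrow> (deriv v ^^ k) x \<in> monomials v"
proof (induction k)
  case (Suc k)
  have "unt v \<in> carr v"
    using Suc.prems part_subset_carr[of v False] by (auto simp: unital_space_def)
  then show ?case using Suc by (auto simp: deriv_def intro: monomials.intros)
qed simp

lemma derivs_in_ideal:
  assumes "is_ideal v I" "unital_space v" "x \<in> I"
  shows "(deriv v ^^ k) x \<in> I"
proof -
  have "unt v \<in> carr v"
    using assms(2) part_subset_carr[of v False] by (auto simp: unital_space_def)
  then have "emb (unt v) \<in> free_alg v" by (rule free_alg.gen)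
  then show ?thesis
    using assms by (induction k) (auto simp: deriv_def is_ideal_def)
qed

lemma soup_ideal_derivation:
  assumes "x \<in> monomials s" "y \<in> monomials s"
  shows "nprod n (deriv s x) y + pscale (of_int n) (nprod (n - 1) x y) \<in> soup_ideal N T s"
  using assms unfolding soup_ideal_def vertex_ideal_def contains_vertex_gens_def by blast

lemma soup_ideal_gens: "soup_gens s \<subseteq> soup_ideal N T s"
  unfolding soup_ideal_def vertex_ideal_def by blast

lemma soup_ideal_vacuum:
  assumes "x \<in> monomials s"
  shows "nprod (- 1) (emb (unt s)) x - x \<in> soup_ideal N T s"
proof -
  have "nprod (- 1) (emb (unt s)) x - x \<in> I" if "contains_vertex_gens s N T I" for I
  proof -
    have "\<forall>n\<in>idx T [x]. nprod n (emb (unt s)) x - (if n = - 1 then x else 0) \<in> I"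
      using that[unfolded contains_vertex_gens_def, THEN conjunct1] assms by (rule bspec)
    then show ?thesis by (auto simp: idx_def dest: bspec[of _ _ "- 1"])
  qed
  then show ?thesis unfolding soup_ideal_def vertex_ideal_def by blast
qed

text \<open>
  The infinite sum of skew symmetry may be truncated once \<open>k\<close> exceeds the bound for the pair
  \<open>(y, x)\<close>: then \<open>y\<^sub>k\<^sub>-\<^sub>1 x\<close> is itself a generator.
\<close>

lemma soup_ideal_skew:
  assumes s: "unital_space s" and x: "x \<in> part s p" and y: "y \<in> part s q" and K: "N y x < K"
  shows "nprod (- 1) (emb x) (emb y) + (\<Sum>k<K. skew_term s p q (- 1) (emb x) (emb y) k)
    \<in> soup_ideal N T s"
proof -
  let ?t = "skew_term s p q (- 1) (emb x) (emb y)"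
  have "nprod (- 1) (emb x) (emb y) + (\<Sum>k<K. ?t k) \<in> I"
    if I: "is_ideal s I" and gens: "contains_vertex_gens s N T I" for I
  proof -
    have xy: "x \<in> carr s" "y \<in> carr s" using part_subset_carr s x y by blast+
    have tail: "- ?t k \<in> I" if "k \<ge> K" for k
    proof -
      have "int (N y x) \<le> - 1 + int k" using that K by linarith
      then have "nprod (- 1 + int k) (emb y) (emb x) \<in> I"
        using gens[unfolded contains_vertex_gens_def, THEN conjunct2, THEN conjunct1] xy by simp
      then have "(deriv s ^^ k) (nprod (- 1 + int k) (emb y) (emb x)) \<in> I"
        by (rule derivs_in_ideal[OF I s])
      then show ?thesis
        using I by (simp add: skew_term_def is_ideal_def pmod.subspace_scale pmod.subspace_neg)
    qed
    have "par_mono s p (emb x)" "par_mono s q (emb y)" using x y by (auto intro: par_mono.gen)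
    then have "\<forall>n\<in>idx T [emb x, emb y]. contains_minus_sum I (nprod n (emb x) (emb y))
        (\<lambda>k. - skew_term s p q n (emb x) (emb y) k)"
      using gens unfolding contains_vertex_gens_def by blast
    then have "contains_minus_sum I (nprod (- 1) (emb x) (emb y)) (\<lambda>k. - ?t k)"
      by (auto simp: idx_def)
    then have "nprod (- 1) (emb x) (emb y) - (\<Sum>k<K. - ?t k) \<in> I"
      using tail unfolding contains_minus_sum_def by blast
    then show ?thesis by (simp add: sum_negf)
  qed
  then show ?thesis unfolding soup_ideal_def vertex_ideal_def by blast
qed

text \<open>
  A second derivative is killed by the product \<open>1\<close>, because \<open>n (n - 1) = 0\<close> for \<open>n = 1\<close>.
\<close>

lemma higher_deriv_product_1_in_ideal:
  assumes s: "unital_space s" and J: "is_ideal s J" "soup_ideal N T s \<subseteq> J"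
    and x: "x \<in> monomials s" and z: "z \<in> monomials s"
  shows "nprod 1 ((deriv s ^^ Suc (Suc k)) x) z \<in> J"
proof -
  let ?y = "(deriv s ^^ k) x"
  have y: "?y \<in> monomials s" "deriv s ?y \<in> monomials s"
    using derivs_in_monomials[OF s x, of k] derivs_in_monomials[OF s x, of "Suc k"] by simp_all
  have "nprod 0 (deriv s ?y) z \<in> J"
    using soup_ideal_derivation[OF y(1) z, of 0 N T] J(2) by auto
  moreover have "nprod 1 (deriv s (deriv s ?y)) z + nprod 0 (deriv s ?y) z \<in> J"
    using soup_ideal_derivation[OF y(2) z, of 1 N T] J(2) by auto
  ultimately show ?thesis
    using ideal_diff[OF J(1)] by fastforce
qed

text \<open>
  The heart of the argument: comparing the two sets of generators with skew symmetry gives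
  \<open>D (a\<^sub>0 g) - D\<^sup>2 (a\<^sub>1 g) / 2 + \<dots> \<in> J\<close>, and the product \<open>1\<close> with \<open>z\<close> isolates the first term.
\<close>

lemma bracket_product_0_in_ideal:
  assumes s: "unital_space s" "fn s \<subseteq> carr s"
    and J: "is_ideal s J" "soup_ideal N T s \<subseteq> J" "right_gens s \<subseteq> J"
    and a: "a \<in> fn s" "a \<in> part s p" and g: "g \<in> part s q" and z: "z \<in> monomials s"
  shows "nprod 0 (emb (brk s a g)) z \<in> J"
proof -
  have sub: "pmod.subspace J" using J(1) by (simp add: is_ideal_def)
  have zF: "z \<in> free_alg s" using z by (rule monomial_in_free_alg)
  have ag: "a \<in> carr s" "g \<in> carr s" using part_subset_carr s a g by blast+
  let ?A = "emb a" and ?G = "emb g" and ?\<sigma> = "sgn2 q p :: 'b"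
  let ?t = "skew_term s q p (- 1) ?G ?A"
  have mono: "nprod n ?A ?G \<in> monomials s" for n
    using ag by (auto intro: monomials.intros)
  \<comment> \<open>one term more than the truncation needs, so that the terms 0 and 1 occur even if \<open>K = 0\<close>\<close>
  define K where "K = N a g"
  have skew: "nprod (- 1) ?G ?A + (\<Sum>k<Suc (Suc K). ?t k) \<in> J"
    using soup_ideal_skew[OF s(1) g a(2), of N "Suc (Suc K)" T] J(2) by (auto simp: K_def)
  have t0: "?t 0 = - pscale ?\<sigma> (nprod (- 1) ?A ?G)"
    by (simp add: skew_term_def power_int_minus)
  have t1: "?t 1 = pscale ?\<sigma> (deriv s (nprod 0 ?A ?G))"
    by (simp add: skew_term_def)
  have "nprod (- 1) ?G ?A - pscale (sgn2 p q) (emb (act s a g)) \<in> J"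
    using J(3) a g unfolding right_gens_def by blast
  then have right: "nprod (- 1) ?G ?A - pscale ?\<sigma> (emb (act s a g)) \<in> J"
    by (simp add: sgn2_def conj_commute)
  have "nprod (- 1) ?A ?G - emb (act s a g) \<in> J"
    using soup_ideal_gens[of s N T] J(2) a(1) ag unfolding soup_gens_def by blast
  then have "pscale ?\<sigma> (nprod (- 1) ?A ?G - emb (act s a g)) \<in> J"
    by (rule pmod.subspace_scale[OF sub])
  with right have "(nprod (- 1) ?G ?A - pscale ?\<sigma> (emb (act s a g)))
      - pscale ?\<sigma> (nprod (- 1) ?A ?G - emb (act s a g)) \<in> J"
    by (rule ideal_diff[OF J(1)])
  then have "nprod (- 1) ?G ?A + ?t 0 \<in> J"
    by (simp add: t0 pmod.scale_right_diff_distrib)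
  from ideal_diff[OF J(1) skew this]
  have "?t 1 + (\<Sum>k<K. ?t (Suc (Suc k))) \<in> J"
    by (simp add: sum.lessThan_Suc_shift del: sum.lessThan_Suc)
  then have "nprod 1 (?t 1 + (\<Sum>k<K. ?t (Suc (Suc k)))) z \<in> J"
    using J(1) zF by (simp add: is_ideal_def)
  moreover have "nprod 1 (\<Sum>k<K. ?t (Suc (Suc k))) z \<in> J"
    unfolding nprod_sum_left skew_term_def nprod_scale_left
    by (intro pmod.subspace_sum[OF sub] pmod.subspace_scale[OF sub]
        higher_deriv_product_1_in_ideal[OF s(1) J(1,2) mono z])
  ultimately have "nprod 1 (?t 1) z \<in> J"
    using ideal_diff[OF J(1)] by (fastforce simp: nprod_add_left)
  \<comment> \<open>the sign is its own inverse, so a second multiplication removes it\<close>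
  then have "pscale ?\<sigma> (pscale ?\<sigma> (nprod 1 (deriv s (nprod 0 ?A ?G)) z)) \<in> J"
    unfolding t1 nprod_scale_left by (rule pmod.subspace_scale[OF sub])
  then have d: "nprod 1 (deriv s (nprod 0 ?A ?G)) z \<in> J"
    by (simp add: sgn2_def split: if_splits)
  have "nprod 1 (deriv s (nprod 0 ?A ?G)) z + nprod 0 (nprod 0 ?A ?G) z \<in> J"
    using soup_ideal_derivation[OF mono[of 0] z, of 1 N T] J(2) by auto
  from ideal_diff[OF J(1) this d] have "nprod 0 (nprod 0 ?A ?G) z \<in> J" by simp
  moreover have "nprod 0 ?A ?G - emb (brk s a g) \<in> J"
    using soup_ideal_gens[of s N T] J(2) ag unfolding soup_gens_def by blast
  then have "nprod 0 (nprod 0 ?A ?G - emb (brk s a g)) z \<in> J"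
    using J(1) zF by (simp add: is_ideal_def)
  ultimately show ?thesis
    using ideal_diff[OF J(1)] by (fastforce simp: nprod_diff_left)
qed

lemma double_bracket_in_ideal:
  assumes s: "unital_space s" "fn s \<subseteq> carr s"
    and J: "is_ideal s J" "soup_ideal N T s \<subseteq> J" "right_gens s \<subseteq> J"
    and a: "a \<in> fn s" "a \<in> part s p" and g: "g \<in> part s q" and h: "h \<in> carr s"
    and brk: "brk s a g \<in> carr s"
  shows "emb (brk s (brk s a g) h) \<in> J"
proof -
  have "nprod 0 (emb (brk s a g)) (emb h) \<in> J"
    using bracket_product_0_in_ideal[OF s J a g] h by (simp add: monomials.gen)
  moreover have "nprod 0 (emb (brk s a g)) (emb h) - emb (brk s (brk s a g) h) \<in> J"
    using soup_ideal_gens[of s N T] J(2) h brk unfolding soup_gens_def by blast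
  ultimately show ?thesis using ideal_diff[OF J(1)] by fastforce
qed

lemma ideal_with_unit_is_everything:
  assumes J: "is_ideal s J" "soup_ideal N T s \<subseteq> J" and unit: "emb (unt s) \<in> J"
  shows "J = free_alg s"
proof
  show "J \<subseteq> free_alg s" using J(1) by (simp add: is_ideal_def)
  have "x \<in> J" if "x \<in> free_alg s" for x
    using that
  proof (induction rule: free_alg.induct)
    case (gen u)
    then have u: "emb u \<in> monomials s" "emb u \<in> free_alg s"
      by (auto intro: monomials.gen free_alg.gen)
    have "nprod (- 1) (emb (unt s)) (emb u) - emb u \<in> J"
      using soup_ideal_vacuum[OF u(1)] J(2) by blast
    moreover have "nprod (- 1) (emb (unt s)) (emb u) \<in> J"
      using J(1) unit u(2) by (simp add: is_ideal_def)
    ultimately show ?case using ideal_diff[OF J(1)] by fastforce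
  next
    case (add x y)
    then show ?case using J(1) by (simp add: is_ideal_def pmod.subspace_add)
  next
    case (prod x y n)
    then show ?case using J(1) by (simp add: is_ideal_def)
  qed
  then show "free_alg s \<subseteq> J" by blast
qed


section \<open>Polynomial functions and vector fields on the line\<close>

definition poly_vec :: "(nat \<Rightarrow> 'i) \<Rightarrow> 'k::field poly \<Rightarrow> ('i, 'k) vec" where
  "poly_vec e p = (\<Sum>n\<le>degree p. Poly_Mapping.single (e n) (coeff p n))"

definition vec_poly :: "(nat \<Rightarrow> 'i) \<Rightarrow> ('i, 'k::field) vec \<Rightarrow> 'k poly" where
  "vec_poly e x = Abs_poly (\<lambda>n. lookup x (e n))"

lemma lookup_poly_vec: "inj e \<Longrightarrow> lookup (poly_vec e p) (e n) = coeff p n"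
  by (auto simp: poly_vec_def lookup_sum lookup_single when_def inj_eq coeff_eq_0)

lemma lookup_poly_vec_outside: "i \<notin> range e \<Longrightarrow> lookup (poly_vec e p) i = 0"
  by (auto simp: poly_vec_def lookup_sum lookup_single when_def intro!: sum.neutral)

lemma coeff_vec_poly: "inj e \<Longrightarrow> coeff (vec_poly e x) n = lookup x (e n)"
proof -
  assume e: "inj e"
  have "finite (e -` keys x)" by (rule finite_vimageI[OF finite_keys e])
  then obtain m where m: "\<forall>n\<in>e -` keys x. n \<le> m" using finite_nat_set_iff_bounded_le by blast
  have "lookup x (e n) = 0" if "n > m" for n
    using m that by (metis in_keys_iff leD vimageI)
  then have "coeff (Abs_poly (\<lambda>n. lookup x (e n))) = (\<lambda>n. lookup x (e n))"
    by (rule coeff_Abs_poly)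
  then show ?thesis by (simp add: vec_poly_def)
qed

text \<open>
  The sum \<open>nat + nat\<close> indexes a basis of pairs \<open>(f, a)\<close> of polynomials; the pair stands for the
  vector field \<open>f \<partial>\<close> plus the function \<open>a\<close>.
\<close>

definition pair_vec :: "(nat + nat \<Rightarrow> 'i) \<Rightarrow> 'k::field poly \<Rightarrow> 'k poly \<Rightarrow> ('i, 'k) vec" where
  "pair_vec e f a = poly_vec (e \<circ> Inl) f + poly_vec (e \<circ> Inr) a"

abbreviation field_of :: "(nat + nat \<Rightarrow> 'i) \<Rightarrow> ('i, 'k::field) vec \<Rightarrow> 'k poly" where
  "field_of e \<equiv> vec_poly (e \<circ> Inl)"

abbreviation function_of :: "(nat + nat \<Rightarrow> 'i) \<Rightarrow> ('i, 'k::field) vec \<Rightarrow> 'k poly" where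
  "function_of e \<equiv> vec_poly (e \<circ> Inr)"

text \<open>
  The vector fields \<open>f \<partial>\<close> act on polynomials by derivations, \<open>\<partial>\<close> being the formal derivative.  Everything
  is even, so that all signs are trivial.
\<close>

definition line_soup :: "(nat + nat \<Rightarrow> 'i) \<Rightarrow> ('i, 'k::field) soup" where
  "line_soup e =
    \<lparr>part = (\<lambda>p. if p then {0} else {pair_vec e f a | f a. True}),
     unt = pair_vec e 0 1,
     lie = {pair_vec e f 0 | f. True},
     fn = {pair_vec e 0 a | a. True},
     brk = (\<lambda>x y. pair_vec e
       (field_of e x * pderiv (field_of e y) - field_of e y * pderiv (field_of e x))
       (field_of e x * pderiv (function_of e y) - field_of e y * pderiv (function_of e x))),
     act = (\<lambda>x y. pair_vec e (function_of e x * field_of e y) (function_of e x * function_of e y))\<rparr>"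

context
  fixes e :: "nat + nat \<Rightarrow> 'i"
  assumes inj_e: "inj e"
begin

lemma inj_e_Inl: "inj (e \<circ> Inl)" and inj_e_Inr: "inj (e \<circ> Inr)"
  using inj_e by (auto simp: inj_def)

lemma lookup_pair_vec:
  "lookup (pair_vec e f a) (e (Inl n)) = coeff f n"
  "lookup (pair_vec e f a) (e (Inr n)) = coeff a n"
  using lookup_poly_vec[OF inj_e_Inl, of f n] lookup_poly_vec[OF inj_e_Inr, of a n] inj_e
  by (auto simp: pair_vec_def lookup_add inj_eq lookup_poly_vec_outside image_iff)

lemma lookup_pair_vec_outside: "i \<notin> range e \<Longrightarrow> lookup (pair_vec e f a) i = 0"
  by (auto simp: pair_vec_def lookup_add lookup_poly_vec_outside image_iff)

lemma field_of_pair_vec [simp]: "field_of e (pair_vec e f a) = f"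
  by (rule poly_eqI) (use lookup_pair_vec in \<open>simp add: coeff_vec_poly inj_e_Inl\<close>)

lemma function_of_pair_vec [simp]: "function_of e (pair_vec e f a) = a"
  by (rule poly_eqI) (use lookup_pair_vec in \<open>simp add: coeff_vec_poly inj_e_Inr\<close>)

lemma pair_vec_eq_iff [simp]: "pair_vec e f a = pair_vec e g b \<longleftrightarrow> f = g \<and> a = b"
  by (metis field_of_pair_vec function_of_pair_vec)

lemma vec_eqI_on_range:
  assumes "\<And>n. lookup x (e (Inl n)) = lookup y (e (Inl n))"
    "\<And>n. lookup x (e (Inr n)) = lookup y (e (Inr n))"
    "\<And>i. i \<notin> range e \<Longrightarrow> lookup x i = lookup y i"
  shows "x = y"
proof (rule poly_mapping_eqI)
  fix i
  show "lookup x i = lookup y i"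
  proof (cases "i \<in> range e")
    case True
    then obtain j where "i = e j" by blast
    then show ?thesis using assms(1,2) by (cases j) auto
  qed (rule assms(3))
qed

lemma pair_vec_add: "pair_vec e f a + pair_vec e g b = pair_vec e (f + g) (a + b)"
  by (rule vec_eqI_on_range) (simp_all add: lookup_add lookup_pair_vec lookup_pair_vec_outside)

lemma pair_vec_scale: "pscale c (pair_vec e f a) = pair_vec e (smult c f) (smult c a)"
  by (rule vec_eqI_on_range) (simp_all add: lookup_pscale lookup_pair_vec lookup_pair_vec_outside)

lemma pair_vec_minus: "- pair_vec e f a = pair_vec e (- f) (- a)"
  by (rule vec_eqI_on_range) (simp_all add: lookup_pair_vec lookup_pair_vec_outside)

lemma zero_as_pair_vec: "0 = pair_vec e 0 0"
  by (rule vec_eqI_on_range) (simp_all add: lookup_pair_vec lookup_pair_vec_outside)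

lemma in_part_line_soup:
  "x \<in> part (line_soup e) p \<longleftrightarrow> (\<exists>f a. x = pair_vec e f a \<and> (p \<longrightarrow> f = 0 \<and> a = 0))"
  by (auto simp: line_soup_def zero_as_pair_vec)

lemma in_lie_line_soup: "x \<in> lie (line_soup e) \<longleftrightarrow> (\<exists>f. x = pair_vec e f 0)"
  by (auto simp: line_soup_def)

lemma in_fn_line_soup: "x \<in> fn (line_soup e) \<longleftrightarrow> (\<exists>a. x = pair_vec e 0 a)"
  by (auto simp: line_soup_def)

lemma unt_line_soup: "unt (line_soup e) = pair_vec e 0 1"
  by (simp add: line_soup_def)

lemma brk_line_soup: "brk (line_soup e) (pair_vec e f a) (pair_vec e g b) =
    pair_vec e (f * pderiv g - g * pderiv f) (f * pderiv b - g * pderiv a)"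
  by (simp add: line_soup_def)

lemma act_line_soup:
  "act (line_soup e) (pair_vec e f a) (pair_vec e g b) = pair_vec e (a * g) (a * b)"
  by (simp add: line_soup_def)

lemma in_carr_line_soup: "x \<in> carr (line_soup e) \<longleftrightarrow> (\<exists>f a. x = pair_vec e f a)"
proof
  assume "\<exists>f a. x = pair_vec e f a"
  then have "x = x + 0" "x \<in> part (line_soup e) False" "0 \<in> part (line_soup e) True"
    by (auto simp: line_soup_def)
  then show "x \<in> carr (line_soup e)" unfolding carr_def by blast
qed (auto simp: carr_def in_part_line_soup pair_vec_add)

lemmas line_soup_simps = in_part_line_soup in_lie_line_soup in_fn_line_soup unt_line_soup
  brk_line_soup act_line_soup in_carr_line_soup pair_vec_add pair_vec_scale pair_vec_minus
  zero_as_pair_vec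

lemma graded_subspace_line_soup:
  assumes "pmod.subspace W" "W \<subseteq> part (line_soup e) False"
  shows "graded_subspace (line_soup e) W"
proof -
  have z: "0 \<in> W \<inter> part (line_soup e) True"
    using assms(1) by (simp add: pmod.subspace_0 line_soup_def)
  have t: "part (line_soup e) True = {0}" by (simp add: line_soup_def)
  have "W = {x + y | x y. x \<in> W \<inter> part (line_soup e) False \<and> y \<in> W \<inter> part (line_soup e) True}"
    using assms(2) z unfolding t by auto
  then show ?thesis using assms(1) unfolding graded_subspace_def by blast
qed

lemma even_bilinear_brk_line_soup:
  "even_bilinear (line_soup e :: ('i, 'k::field) soup) (carr (line_soup e)) (carr (line_soup e))
     (brk (line_soup e))"
  unfolding even_bilinear_def
proof (intro conjI allI ballI)
  let ?s = "line_soup e :: ('i, 'k) soup"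
  show "brk ?s x y \<in> part ?s (p \<noteq> q)"
    if "x \<in> carr ?s \<inter> part ?s p" "y \<in> carr ?s \<inter> part ?s q" for p q x y
    using that by (auto simp: in_part_line_soup brk_line_soup)
qed (auto simp: in_carr_line_soup brk_line_soup pair_vec_add pair_vec_scale pderiv_add pderiv_smult
    smult_diff_right algebra_simps)

lemma souped_up_line_soup: "souped_up (line_soup e :: ('i, 'k::field) soup)"
  unfolding souped_up_def
proof (intro conjI allI ballI)
  let ?s = "line_soup e :: ('i, 'k) soup"
  have "pmod.subspace (part ?s p)" for p
    by (rule pmod.subspaceI) (force simp: line_soup_simps)+
  then show "unital_space ?s"
    by (auto simp: unital_space_def line_soup_simps)
  show "graded_subspace ?s (lie ?s)"
    by (rule graded_subspace_line_soup, rule pmod.subspaceI) (force simp: line_soup_simps)+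
  show "graded_subspace ?s (fn ?s)"
    by (rule graded_subspace_line_soup, rule pmod.subspaceI) (force simp: line_soup_simps)+
  show "lie ?s \<inter> fn ?s = {0}"
    by (auto simp: line_soup_simps)
  show "carr ?s = {g + a | g a. g \<in> lie ?s \<and> a \<in> fn ?s}"
    by (force simp: line_soup_simps)
  show "unt ?s \<in> fn ?s" and "unt ?s \<noteq> 0"
    by (auto simp: line_soup_simps)
  show "even_bilinear ?s (carr ?s) (carr ?s) (brk ?s)"
    by (rule even_bilinear_brk_line_soup)
  show "brk ?s x y = - pscale (sgn2 p q) (brk ?s y x)"
    if "x \<in> part ?s p" "y \<in> part ?s q" for p q x y
    using that by (auto simp: line_soup_simps sgn2_def)
  show "brk ?s x (brk ?s y z) =
      brk ?s (brk ?s x y) z + pscale (sgn2 p q) (brk ?s y (brk ?s x z))"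
    if "x \<in> part ?s p" "y \<in> part ?s q" "z \<in> part ?s r" for p q r x y z
    using that by (auto simp: line_soup_simps sgn2_def pderiv_diff pderiv_mult algebra_simps)
  show "brk ?s g h \<in> lie ?s" if "g \<in> lie ?s" "h \<in> lie ?s" for g h
    using that by (auto simp: line_soup_simps)
  show "brk ?s g a \<in> fn ?s" if "g \<in> lie ?s" "a \<in> fn ?s" for g a
    using that by (auto simp: line_soup_simps)
  show "brk ?s a b = 0" if "a \<in> fn ?s" "b \<in> fn ?s" for a b
    using that by (auto simp: line_soup_simps)
  show "even_bilinear ?s (fn ?s) (carr ?s) (act ?s)"
    unfolding even_bilinear_def
    by (auto simp: line_soup_simps algebra_simps)
  show "act ?s a b \<in> fn ?s" if "a \<in> fn ?s" "b \<in> fn ?s" for a b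
    using that by (auto simp: line_soup_simps)
  show "act ?s a g \<in> lie ?s" if "a \<in> fn ?s" "g \<in> lie ?s" for a g
    using that by (auto simp: line_soup_simps)
  show "act ?s a b = pscale (sgn2 p q) (act ?s b a)"
    if "a \<in> fn ?s \<inter> part ?s p" "b \<in> fn ?s \<inter> part ?s q" for p q a b
    using that by (auto simp: line_soup_simps sgn2_def mult.commute)
  show "act ?s (act ?s a b) x = act ?s a (act ?s b x)"
    if "a \<in> fn ?s" "b \<in> fn ?s" "x \<in> carr ?s" for a b x
    using that by (auto simp: line_soup_simps mult.assoc)
  show "act ?s (unt ?s) x = x" if "x \<in> carr ?s" for x
    using that by (auto simp: line_soup_simps)
  show "brk ?s g (act ?s a b) =
      act ?s (brk ?s g a) b + pscale (sgn2 p q) (act ?s a (brk ?s g b))"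
    if "g \<in> lie ?s \<inter> part ?s p" "a \<in> fn ?s \<inter> part ?s q" "b \<in> fn ?s" for p q g a b
    using that by (auto simp: line_soup_simps sgn2_def pderiv_mult algebra_simps)
  show "brk ?s g (act ?s a h) =
      act ?s (brk ?s g a) h + pscale (sgn2 p q) (act ?s a (brk ?s g h))"
    if "g \<in> lie ?s \<inter> part ?s p" "a \<in> fn ?s \<inter> part ?s q" "h \<in> lie ?s" for p q g a h
    using that by (auto simp: line_soup_simps sgn2_def pderiv_mult algebra_simps)
qed

text \<open>
  The function \<open>X\<close> is an eigenvector of \<open>X \<partial>\<close>, so its bracket with \<open>X \<partial>\<close> is \<open>- X\<close>, and the bracket of
  \<open>- X\<close> with \<open>\<partial>\<close> is \<open>\<one>\<close>.
\<close>

lemma unit_in_ideal_with_right_gens: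
  fixes J :: "('i, 'k::field_char_0) alg set"
  assumes J: "is_ideal (line_soup e) J" "soup_ideal N T (line_soup e) \<subseteq> J"
    "right_gens (line_soup e) \<subseteq> J"
  shows "emb (unt (line_soup e)) \<in> J"
proof -
  let ?s = "line_soup e :: ('i, 'k) soup" and ?X = "[:0, 1:] :: 'k poly"
  have "souped_up ?s" by (rule souped_up_line_soup)
  then have "unital_space ?s" by (simp add: souped_up_def)
  then have "emb (brk ?s (brk ?s (pair_vec e 0 ?X) (pair_vec e ?X 0)) (pair_vec e 1 0)) \<in> J"
    by (rule double_bracket_in_ideal[OF _ _ J, where p = False and q = False])
      (auto simp: line_soup_simps)
  moreover have "brk ?s (brk ?s (pair_vec e 0 ?X) (pair_vec e ?X 0)) (pair_vec e 1 0) = unt ?s"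
    by (simp add: line_soup_simps pderiv_pCons one_pCons)
  ultimately show ?thesis by simp
qed

end


section \<open>The enlarged relations are inconsistent\<close>

theorem proposition4p8:
  fixes N :: nat
    and T :: "('i, 'k::field_char_0) soup \<Rightarrow> ('i, 'k) alg list \<Rightarrow> nat"
  assumes "infinite (UNIV :: 'i set)"
    and "\<And>s :: ('i, 'k) soup. souped_up s \<Longrightarrow>
           soup_ideal (\<lambda>_ _. N) (T s) s \<inter> emb ` carr s = {0}"
  shows "\<exists>s :: ('i, 'k) soup. souped_up s \<and>
           soup_ideal (\<lambda>_ _. N) (T s) s \<inter> emb ` carr s = {0} \<and>
           enlarged_soup_ideal (\<lambda>_ _. N) (T s) s \<inter> emb ` carr s \<noteq> {0} \<and>
           \<not> (\<exists>J. defines_vertex_algebra (\<lambda>_ _. N) (T s) s J \<and> right_gens s \<subseteq> J)"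
proof -
  obtain \<iota> :: "nat \<Rightarrow> 'i" where "inj \<iota>"
    using infinite_countable_subset[OF assms(1)] by blast
  then have e: "inj (\<iota> \<circ> sum_encode)" by (simp add: inj_compose inj_sum_encode)
  define s :: "('i, 'k) soup" where "s = line_soup (\<iota> \<circ> sum_encode)"
  have s: "souped_up s" unfolding s_def by (rule souped_up_line_soup[OF e])
  have unit: "emb (unt s) \<in> J"
    if "is_ideal s J" "soup_ideal (\<lambda>_ _. N) (T s) s \<subseteq> J" "right_gens s \<subseteq> J" for J
    using that unit_in_ideal_with_right_gens[OF e] unfolding s_def by blast
  have "emb (unt s) \<in> I"
    if "is_ideal s I" "contains_vertex_gens s (\<lambda>_ _. N) (T s) I" "soup_gens s \<union> right_gens s \<subseteq> I"
    for I
    by (rule unit) (use that in \<open>auto simp: soup_ideal_def vertex_ideal_def\<close>)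
  then have "emb (unt s) \<in> enlarged_soup_ideal (\<lambda>_ _. N) (T s) s"
    unfolding enlarged_soup_ideal_def vertex_ideal_def by blast
  moreover have "unt s \<in> carr s"
    using s part_subset_carr[of s False] by (auto simp: souped_up_def unital_space_def)
  moreover have "emb (unt s) \<noteq> 0" using s by (simp add: souped_up_def emb_eq_0_iff)
  ultimately have "enlarged_soup_ideal (\<lambda>_ _. N) (T s) s \<inter> emb ` carr s \<noteq> {0}" by blast
  moreover have "\<not> (\<exists>J. defines_vertex_algebra (\<lambda>_ _. N) (T s) s J \<and> right_gens s \<subseteq> J)"
    using unit ideal_with_unit_is_everything unfolding defines_vertex_algebra_def by blast
  ultimately show ?thesis using s assms(2)[OF s] by blast
qed

end
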